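(* Let $C$ be a closed convex cone in $H$, $K$ a nonempty closed convex subset of $H$, and let $f:C\to H$ and $g:H\to H$ be weakly homogeneous mappings of degrees $\delta_1>0$ and $\delta_2>0$, respectively, with leading terms $f^\infty$ and $g^\infty$. Assume $g^{-1}(K)\subseteq C$. For $\hat x\in H$ and $r>\|\Pi_K(\hat x)\|$ put $\Omega^{\hat x}_r:=\{x\in H\mid \|g(x)\|<r\}$. Suppose that for any given $\hat x\in H$ and every $r>\|\Pi_K(\hat x)\|$ the degree $\deg(g,\Omega^{\hat x}_r,\Pi_K(\hat x))$ is defined and nonzero, and that the following conditions hold: (i) $f$ is strictly monotone with respect to $g$ on $K$; and (ii) $\langle f^\infty(x),g^\infty(x)\rangle\ne 0$ for any $x\in C$ with $\|x\|=1$ and $g^\infty(x)\in K^\infty$. Then WHGVI$(f,g,K)$ has a unique solution.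
   Context: $H$ is a finite dimensional real Hilbert space with inner product $\langle\cdot,\cdot\rangle$ and norm $\|\cdot\|$; $\Pi_K$ is the orthogonal projection onto $K$; $g^{-1}(K)=\{x\in H\mid g(x)\in K\}$. Weakly homogeneous mappings: let $D\subseteq H$ be a closed convex cone ($D=C$ for $f$, $D=H$ for $g$). A continuous $h:D\to H$ is positively homogeneous of degree $\delta$ if $h(\lambda x)=\lambda^\delta h(x)$ for all $x\in D$, $\lambda>0$. A mapping $\varphi:D\to H$ is weakly homogeneous of degree $\delta>0$ if $\varphi=h+e$ with $h$ positively homogeneous of degree $\delta$ and $e:D\to H$ continuous with $e(x)/\|x\|^\delta\to0$ as $\|x\|\to\infty$ in $D$. Then $h$ is uniquely determined; it is called the leading term of $\varphi$ and denoted $\varphi^\infty$. Recession cone: $K^\infty:=\{u\in H\mid \exists t_k\to\infty,\ \exists x^k\in K \text{ such that } x^k/t_k\to u\}$. WHGVI$(f,g,K)$ is the problem of finding $x^*\in H$ such that $g(x^* )\in K$ and $\langle f(x^* ),y-g(x^* )\rangle\ge0$ for all $y\in K$. $f$ is strictly monotone with respect to $g$ on $K$ if $g(x),g(y)\in K$ and $x\ne y$ imply $\langle f(x)-f(y),g(x)-g(y)\rangle>0$. $\deg(\phi,\Omega,b)$ is the topological (Brouwer) degree; it is defined when $\Omega\subset H$ is bounded and open, $\phi:\bar\Omega\to H$ is continuous, and $b\notin\phi(\partial\Omega)$. *)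

theory Defs
  imports "HOL-Homology.Homology"
begin

text \<open>A finite dimensional real Hilbert space is rendered as a type of class
  \<^class>\<open>euclidean_space\<close>. A mapping with domain \<open>D\<close> is a total function of which only the
  values on \<open>D\<close> are constrained.\<close>

definition positively_homogeneous_on ::
  "'a::euclidean_space set \<Rightarrow> real \<Rightarrow> ('a \<Rightarrow> 'a) \<Rightarrow> bool" where
  "positively_homogeneous_on D \<delta> h \<longleftrightarrow>
     continuous_on D h \<and> (\<forall>x\<in>D. \<forall>l>0. h (l *\<^sub>R x) = (l powr \<delta>) *\<^sub>R h x)"

text \<open>The leading term is unique only on \<open>D\<close>, so it is given by a predicate.
  The filter expresses that the norm of \<open>x\<close> tends to infinity within \<open>D\<close>.\<close>

definition is_leading_term ::
  "'a::euclidean_space set \<Rightarrow> real \<Rightarrow> ('a \<Rightarrow> 'a) \<Rightarrow> ('a \<Rightarrow> 'a) \<Rightarrow> bool" where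
  "is_leading_term D \<delta> \<phi> h \<longleftrightarrow>
     positively_homogeneous_on D \<delta> h \<and>
     (\<exists>e. continuous_on D e \<and> (\<forall>x\<in>D. \<phi> x = h x + e x) \<and>
          ((\<lambda>x. e x /\<^sub>R (norm x powr \<delta>)) \<longlongrightarrow> 0) (inf at_infinity (principal D)))"

definition weakly_homogeneous_on ::
  "'a::euclidean_space set \<Rightarrow> real \<Rightarrow> ('a \<Rightarrow> 'a) \<Rightarrow> bool" where
  "weakly_homogeneous_on D \<delta> \<phi> \<longleftrightarrow> \<delta> > 0 \<and> (\<exists>h. is_leading_term D \<delta> \<phi> h)"

definition recession_cone :: "'a::euclidean_space set \<Rightarrow> 'a set" where
  "recession_cone K =
     {u. \<exists>(t :: nat \<Rightarrow> real) x. filterlim t at_top sequentially \<and> (\<forall>k. x k \<in> K) \<and>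
           (\<lambda>k. x k /\<^sub>R t k) \<longlonglongrightarrow> u}"

definition WHGVI_solution ::
  "('a::euclidean_space \<Rightarrow> 'a) \<Rightarrow> ('a \<Rightarrow> 'a) \<Rightarrow> 'a set \<Rightarrow> 'a \<Rightarrow> bool" where
  "WHGVI_solution f g K x \<longleftrightarrow> g x \<in> K \<and> (\<forall>y\<in>K. f x \<bullet> (y - g x) \<ge> 0)"

definition strictly_monotone_wrt ::
  "('a::euclidean_space \<Rightarrow> 'a) \<Rightarrow> ('a \<Rightarrow> 'a) \<Rightarrow> 'a set \<Rightarrow> bool" where
  "strictly_monotone_wrt f g K \<longleftrightarrow>
     (\<forall>x y. g x \<in> K \<and> g y \<in> K \<and> x \<noteq> y \<longrightarrow> (f x - f y) \<bullet> (g x - g y) > 0)"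

definition degree_defined ::
  "('a::euclidean_space \<Rightarrow> 'a) \<Rightarrow> 'a set \<Rightarrow> 'a \<Rightarrow> bool" where
  "degree_defined \<phi> \<Omega> b \<longleftrightarrow>
     bounded \<Omega> \<and> open \<Omega> \<and> continuous_on (closure \<Omega>) \<phi> \<and> b \<notin> \<phi> ` frontier \<Omega>"

text \<open>The Brouwer degree in its standard homological form (Dold, \<open>Lectures on Algebraic
  Topology\<close>, IV.5). Let \<open>n\<close> be the dimension of the space \<open>H\<close> and let \<open>P\<close> be the compact set
  of preimages of \<open>b\<close> in \<open>\<Omega>\<close>. For a ball \<open>B\<close> containing \<open>P\<close> and \<open>b\<close>, inclusion maps the infinite
  cyclic group \<open>H\<^sub>n(H, H - B)\<close> isomorphically onto \<open>H\<^sub>n(H, H - {b})\<close>, and it also maps it to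
  \<open>H\<^sub>n(H, H - P)\<close>, which is isomorphic to \<open>H\<^sub>n(\<Omega>, \<Omega> - P)\<close> by excision. If \<open>z\<close> in \<open>H\<^sub>n(H, H - B)\<close>
  and \<open>c\<close> in \<open>H\<^sub>n(\<Omega>, \<Omega> - P)\<close> have the same image in \<open>H\<^sub>n(H, H - P)\<close>, then \<open>\<phi>\<close> sends \<open>c\<close> to \<open>d\<close>
  times the image of \<open>z\<close> in \<open>H\<^sub>n(H, H - {b})\<close>, where \<open>d\<close> is the degree. Using the same \<open>z\<close>
  on both sides makes the choice of an orientation irrelevant. The homology groups are
  written multiplicatively, so \<open>d\<close> is an exponent.
  The value is meaningful only under \<^const>\<open>degree_defined\<close>.\<close>

definition brouwer_degree ::
  "('a::euclidean_space \<Rightarrow> 'a) \<Rightarrow> 'a set \<Rightarrow> 'a \<Rightarrow> int" where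
  "brouwer_degree \<phi> \<Omega> b =
     (let n = int DIM('a);
          P = {x \<in> \<Omega>. \<phi> x = b};
          X = top_of_set \<Omega>
      in THE d::int. \<forall>R z c.
           P \<subseteq> ball 0 R \<and> b \<in> ball 0 R \<and>
           z \<in> carrier (relative_homology_group n euclidean (- ball 0 R)) \<and>
           c \<in> carrier (relative_homology_group n X (\<Omega> - P)) \<and>
           hom_induced n X (\<Omega> - P) euclidean (- P) id c =
             hom_induced n euclidean (- ball 0 R) euclidean (- P) id z
           \<longrightarrow>
           hom_induced n X (\<Omega> - P) euclidean (- {b}) \<phi> c =
             hom_induced n euclidean (- ball 0 R) euclidean (- {b}) id z
               [^]\<^bsub>relative_homology_group n euclidean (- {b})\<^esub> d)"

end

theory Submission
  imports Defs "HOL-Real_Asymp.Multiseries_Expansion"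
begin

text \<open>The solutions are the points with \<open>g x = \<Pi>\<^sub>K (g x - f x)\<close>. Deform this
  equation to \<open>g x = \<Pi>\<^sub>K a\<close> through \<open>g x = \<Pi>\<^sub>K (t (g x - f x) + (1 - t) a)\<close>.
  Along a sequence of solutions of the deformed equations with norms tending to infinity, the
  directions subconverge to a unit vector \<open>u\<close> of \<open>C\<close> with \<open>g\<^sup>\<infinity> u\<close> in the recession
  cone of \<open>K\<close>. Monotonicity forces \<open>\<langle>f\<^sup>\<infinity> u, g\<^sup>\<infinity> u\<rangle> \<ge> 0\<close>, so it is positive by
  (ii), and this contradicts the variational inequality of the deformed problem tested with one
  point of \<open>K\<close> that does not vary along the sequence. Hence all these solutions lie in one set \<open>\<Omega>\<close>, and if there were none
  at \<open>t = 1\<close>, homotopy invariance would make the degree of \<open>g\<close> vanish.\<close>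

section \<open>Relative homology of complements in Euclidean space\<close>

lemma iso_preimage:
  assumes "f \<in> iso G H" and "y \<in> carrier H"
  obtains x where "x \<in> carrier G" and "f x = y"
proof -
  have "f ` carrier G = carrier H"
    using assms(1) by (simp add: iso_def bij_betw_def)
  then show ?thesis
    using assms(2) that by (metis imageE)
qed

text \<open>Coordinates in the standard basis, then scaling and translation, transport the known
  group of \<open>nsphere\<close>. Reduced homology also covers dimension 1, where the sphere has
  two points and the degree is 0.\<close>

lemma sphere_reduced_homology_group:
  fixes a :: "'a::euclidean_space"
  assumes "r > 0"
  shows "reduced_homology_group (int DIM('a) - 1) (top_of_set (sphere a r)) \<cong> integer_group"
proof -
  obtain f :: "(nat \<Rightarrow> real) \<Rightarrow> 'a" and g
    where "homeomorphic_maps (nsphere (DIM('a) - 1)) (top_of_set (sphere 0 1 \<inter> span Basis)) f g"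
    using homeomorphic_maps_nsphere_euclidean_sphere
      [OF independent_Basis orthogonal_Basis refl _ norm_Basis] by auto
  then have "nsphere (DIM('a) - 1) homeomorphic_space top_of_set (sphere 0 1 :: 'a set)"
    by (auto simp: homeomorphic_space_def)
  moreover have "top_of_set (sphere 0 1 :: 'a set) homeomorphic_space top_of_set (sphere a r)"
  proof -
    have "homeomorphic_maps (top_of_set (sphere 0 1)) (top_of_set (sphere a r))
        (\<lambda>x. a + r *\<^sub>R x) (\<lambda>y. (1 / r) *\<^sub>R (y - a))"
      using assms by (auto simp: homeomorphic_maps_def dist_norm norm_minus_commute
          intro!: continuous_intros)
    then show ?thesis
      unfolding homeomorphic_space_def by blast
  qed
  ultimately have "nsphere (DIM('a) - 1) homeomorphic_space top_of_set (sphere a r)"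
    by (rule homeomorphic_space_trans)
  then have "top_of_set (sphere a r) homeomorphic_space nsphere (DIM('a) - 1)"
    by (rule iffD1[OF homeomorphic_space_sym])
  then have "reduced_homology_group p (top_of_set (sphere a r))
      \<cong> reduced_homology_group p (nsphere (DIM('a) - 1))" for p
    by (intro homotopy_equivalent_space_imp_isomorphic_reduced_homology_groups
        homeomorphic_imp_homotopy_equivalent_space)
  from iso_trans[OF this reduced_homology_group_nsphere(1)] show ?thesis
    by (simp add: Suc_leI of_nat_diff)
qed

lemma infinite_order_of_iso_integer_group:
  assumes "group G" and "G \<cong> integer_group"
  obtains s where "s \<in> carrier G" and "\<And>d::int. s [^]\<^bsub>G\<^esub> d = \<one>\<^bsub>G\<^esub> \<Longrightarrow> d = 0"
proof -
  obtain \<phi> where \<phi>: "\<phi> \<in> iso G integer_group"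
    using assms(2) by (auto simp: is_iso_def)
  interpret group_hom G integer_group \<phi>
    using \<phi> assms(1) by (simp add: group_hom_axioms_def group_hom_def iso_def)
  obtain s where s: "s \<in> carrier G" "\<phi> s = 1"
    using iso_preimage[OF \<phi>, of 1] by auto
  have "d = 0" if "s [^]\<^bsub>G\<^esub> d = \<one>\<^bsub>G\<^esub>" for d :: int
    using hom_int_pow[OF s(1), of d] s(2) that by simp
  with s(1) show ?thesis
    using that by blast
qed

text \<open>Radial projection from \<open>b\<close> is a left inverse of the inclusion. Hence the
  inclusion is injective on homology, and an element of infinite order on the sphere keeps it in
  punctured space.\<close>

lemma section_map_sphere_punctured:
  fixes b :: "'a::euclidean_space"
  assumes "r > 0"
  shows "section_map (top_of_set (sphere b r)) (top_of_set (- {b})) id"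
  unfolding section_map_def retraction_maps_def
proof (intro exI conjI ballI)
  show "continuous_map (top_of_set (sphere b r)) (top_of_set (- {b})) id"
    using assms by auto
  show "continuous_map (top_of_set (- {b})) (top_of_set (sphere b r))
      (\<lambda>x. b + (r / norm (x - b)) *\<^sub>R (x - b))"
    using assms by (auto simp: dist_norm intro!: continuous_intros)
  show "b + (r / norm (id x - b)) *\<^sub>R (id x - b) = x" if "x \<in> topspace (top_of_set (sphere b r))" for x
    using that assms by (auto simp: dist_norm norm_minus_commute)
qed

text \<open>This makes the degree unique in the definite description that defines it.\<close>

lemma infinite_order_punctured_space:
  fixes b :: "'a::euclidean_space"
  assumes "b \<in> ball 0 R"
  obtains z where "z \<in> carrier (relative_homology_group (int DIM('a)) euclidean (- ball (0::'a) R))"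
    and "\<forall>d::int. hom_induced (int DIM('a)) euclidean (- ball 0 R) euclidean (- {b}) id z
           [^]\<^bsub>relative_homology_group (int DIM('a)) euclidean (- {b})\<^esub> d
           = \<one>\<^bsub>relative_homology_group (int DIM('a)) euclidean (- {b})\<^esub> \<longrightarrow> d = 0"
proof -
  define n where "n = int DIM('a)"
  \<comment> \<open>With this radius the sphere around \<open>b\<close> lies outside
    \<open>ball 0 R\<close>, so its class can be pushed into the complement of the ball and on into
    the complement of \<open>b\<close>.\<close>
  define r where "r = R + norm b"
  have "R > 0"
    using assms norm_ge_zero[of b] by (simp del: norm_ge_zero)
  then have "r > 0"
    by (simp add: r_def add_pos_nonneg)
  let ?S = "top_of_set (sphere b r)"
  let ?B = "top_of_set (- ball (0::'a) R)"
  let ?Y = "top_of_set (- {b})"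
  let ?Z = "relative_homology_group n euclidean (- {b})"
  obtain s where s: "s \<in> carrier (reduced_homology_group (n - 1) ?S)"
    and s_inf: "\<And>d::int. s [^]\<^bsub>reduced_homology_group (n - 1) ?S\<^esub> d
        = \<one>\<^bsub>reduced_homology_group (n - 1) ?S\<^esub> \<Longrightarrow> d = 0"
    using infinite_order_of_iso_integer_group[OF group_reduced_homology_group
        sphere_reduced_homology_group[OF \<open>r > 0\<close>, of b]] unfolding n_def by blast
  have s': "s \<in> carrier (homology_group (n - 1) ?S)"
    using s carrier_reduced_homology_group_subset by blast
  have SB: "sphere b r \<subseteq> - ball 0 R"
  proof
    fix x assume "x \<in> sphere b r"
    then show "x \<in> - ball 0 R"
      using norm_triangle_ineq4[of b x] by (simp add: r_def dist_norm)
  qed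
  have BY: "- ball 0 R \<subseteq> - {b}"
    using assms by auto
  \<comment> \<open>The whole space is contractible, so the connecting homomorphism is an
    isomorphism and the class \<open>s\<close> of the sphere lifts to \<open>z\<close>.\<close>
  have "hom_boundary n euclidean (- ball (0::'a) R) \<in>
      iso (relative_homology_group n euclidean (- ball (0::'a) R)) (reduced_homology_group (n - 1) ?B)"
  proof (rule iso_relative_homology_of_contractible)
    show "contractible_space (euclidean :: 'a topology)"
      using contractible_space_top_of_set[of "UNIV :: 'a set"] by (simp add: convex_imp_contractible)
    show "topspace euclidean \<inter> - ball (0::'a) R \<noteq> {}"
      using SB \<open>r > 0\<close> by (metis Int_UNIV_left sphere_eq_empty subset_empty topspace_euclidean not_less_iff_gr_or_eq)
  qed
  moreover have "hom_induced (n - 1) ?S {} ?B {} id s \<in> carrier (reduced_homology_group (n - 1) ?B)"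
    using s hom_induced_reduced_hom hom_in_carrier by metis
  ultimately obtain z where z: "z \<in> carrier (relative_homology_group n euclidean (- ball (0::'a) R))"
    and zs: "hom_boundary n euclidean (- ball (0::'a) R) z = hom_induced (n - 1) ?S {} ?B {} id s"
    by (rule iso_preimage)
  define w where "w = hom_induced n euclidean (- ball 0 R) euclidean (- {b}) id z"
  have w: "w \<in> carrier ?Z"
    by (simp add: w_def hom_induced_carrier)
  \<comment> \<open>By naturality of the boundary, \<open>w\<close> has as boundary the image of
    \<open>s\<close> in punctured space. A relation on powers of \<open>w\<close> thus becomes one
    on powers of \<open>s\<close>.\<close>
  have "hom_boundary n euclidean (- {b}) w =
      hom_induced (n - 1) ?B {} ?Y {} id (hom_boundary n euclidean (- ball (0::'a) R) z)"
    using fun_cong[OF naturality_hom_induced[of euclidean euclidean id "- ball 0 R" "- {b}" n], of z] BY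
    by (simp add: w_def image_subset_iff_funcset[symmetric])
  also have "\<dots> = hom_induced (n - 1) ?S {} ?Y {} (id \<circ> id) s"
    unfolding zs using SB BY by (intro hom_induced_compose') auto
  finally have bw: "hom_boundary n euclidean (- {b}) w = hom_induced (n - 1) ?S {} ?Y {} id s"
    by simp
  have "\<forall>d::int. w [^]\<^bsub>?Z\<^esub> d = \<one>\<^bsub>?Z\<^esub> \<longrightarrow> d = 0"
  proof (intro allI impI, rule s_inf)
    fix d :: int assume d: "w [^]\<^bsub>?Z\<^esub> d = \<one>\<^bsub>?Z\<^esub>"
    interpret bd: group_hom ?Z "homology_group (n - 1) ?Y" "hom_boundary n euclidean (- {b})"
      using hom_boundary_hom[of n euclidean "- {b}"] by (simp add: group_hom_def group_hom_axioms_def)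
    interpret j: group_hom "homology_group (n - 1) ?S" "homology_group (n - 1) ?Y"
        "hom_induced (n - 1) ?S {} ?Y {} id"
      by (simp add: group_hom_def group_hom_axioms_def hom_induced_hom)
    have "hom_induced (n - 1) ?S {} ?Y {} id (s [^]\<^bsub>homology_group (n - 1) ?S\<^esub> d)
        = hom_boundary n euclidean (- {b}) (w [^]\<^bsub>?Z\<^esub> d)"
      by (simp only: j.hom_int_pow[OF s'] bd.hom_int_pow[OF w] bw)
    also have "\<dots> = hom_induced (n - 1) ?S {} ?Y {} id \<one>\<^bsub>homology_group (n - 1) ?S\<^esub>"
      by (simp only: d bd.hom_one j.hom_one)
    finally have "s [^]\<^bsub>homology_group (n - 1) ?S\<^esub> d = \<one>\<^bsub>homology_group (n - 1) ?S\<^esub>"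
      using inj_onD[OF inj_on_hom_induced_section_map[OF section_map_sphere_punctured[OF \<open>r > 0\<close>]]] s'
      by blast
    then show "s [^]\<^bsub>reduced_homology_group (n - 1) ?S\<^esub> d = \<one>\<^bsub>reduced_homology_group (n - 1) ?S\<^esub>"
      using s unfolding reduced_homology_group_def
      by (simp add: group.int_pow_subgroup_generated)
  qed
  then show ?thesis
    by (rule that[OF z[unfolded n_def], folded n_def, folded w_def])
qed

text \<open>Scaling by \<open>R / R'\<close> is a homeomorphism of the two pairs and is homotopic to
  the identity through maps of pairs, so the inclusion induces an isomorphism too. This permits
  enlarging the ball in the definition of the degree.\<close>

lemma surj_relative_homology_complement_ball:
  fixes z :: "'a::euclidean_space chain set"
  assumes "0 < R" "R \<le> R'"
    and z: "z \<in> carrier (relative_homology_group p euclidean (- ball (0::'a) R))"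
  obtains z' where "z' \<in> carrier (relative_homology_group p euclidean (- ball (0::'a) R'))"
    and "hom_induced p euclidean (- ball 0 R') euclidean (- ball 0 R) id z' = z"
proof -
  let ?s = "\<lambda>x::'a. (R / R') *\<^sub>R x"
  have "R' > 0" using assms by simp
  have hom: "homeomorphic_map euclidean euclidean ?s"
  proof -
    have "homeomorphic_maps euclidean euclidean ?s (\<lambda>x. (R' / R) *\<^sub>R x)"
      using assms \<open>R' > 0\<close> by (auto simp: homeomorphic_maps_def intro!: continuous_intros)
    then show ?thesis using homeomorphic_map_maps by blast
  qed
  have "?s ` (- ball 0 R') = - ball 0 R"
  proof (intro equalityI subsetI)
    show "x \<in> - ball 0 R" if "x \<in> ?s ` (- ball 0 R')" for x
      using that assms \<open>R' > 0\<close> by (auto simp: field_simps)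
    show "x \<in> ?s ` (- ball 0 R')" if "x \<in> - ball 0 R" for x
    proof (rule image_eqI)
      show "x = ?s ((R' / R) *\<^sub>R x)" using assms \<open>R' > 0\<close> by simp
      show "(R' / R) *\<^sub>R x \<in> - ball 0 R'" using that assms \<open>R' > 0\<close> by (auto simp: field_simps)
    qed
  qed
  then have "hom_induced p euclidean (- ball 0 R') euclidean (- ball 0 R) ?s \<in>
      iso (relative_homology_group p euclidean (- ball 0 R')) (relative_homology_group p euclidean (- ball 0 R))"
    using homeomorphic_map_relative_homology_iso[OF hom] by simp
  moreover have "hom_induced p euclidean (- ball 0 R') euclidean (- ball 0 R) id =
      hom_induced p euclidean (- ball 0 R') euclidean (- ball 0 R) ?s"
  proof (rule homology_homotopy_axiom)
    \<comment> \<open>The factor never falls below \<open>R / R'\<close>, so points of norm at least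
      \<open>R'\<close> keep norm at least \<open>R\<close> throughout.\<close>
    let ?h = "\<lambda>(t, x::'a). (1 - t + t * (R / R')) *\<^sub>R x"
    have "?h (t, x) \<in> - ball 0 R" if "t \<in> {0..1}" "x \<in> - ball 0 R'" for t x
    proof -
      have "R / R' \<le> 1" using assms \<open>R' > 0\<close> by simp
      then have "R / R' \<le> 1 - t + t * (R / R')"
        using mult_right_mono[of t 1 "1 - R / R'"] that(1) by (simp add: algebra_simps)
      then have "R / R' * R' \<le> (1 - t + t * (R / R')) * norm x"
        using that assms \<open>R' > 0\<close> by (intro mult_mono) auto
      moreover have "0 \<le> 1 - t + t * (R / R')"
        using that assms \<open>R' > 0\<close> by simp
      ultimately show ?thesis
        using \<open>R' > 0\<close> by simp
    qed
    then have "\<forall>t\<in>{0..1}. (\<lambda>x. ?h (t, x)) \<in> - ball 0 R' \<rightarrow> - ball 0 R"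
      by blast
    moreover have "continuous_map (prod_topology (top_of_set {0..1}) euclidean) euclidean ?h"
      using prod_topology_subtopology_eu[of "{0..1::real}" "UNIV :: 'a set"]
      using \<open>R' > 0\<close> by (simp add: case_prod_unfold) (intro continuous_intros; simp)
    ultimately show "homotopic_with (\<lambda>h. h \<in> - ball 0 R' \<rightarrow> - ball 0 R) euclidean euclidean id ?s"
      unfolding homotopic_with_def by (intro exI[of _ ?h] conjI) simp_all
  qed
  ultimately have "hom_induced p euclidean (- ball (0::'a) R') euclidean (- ball 0 R) id \<in>
      iso (relative_homology_group p euclidean (- ball 0 R')) (relative_homology_group p euclidean (- ball 0 R))"
    by simp
  then show ?thesis
    using z that by (rule iso_preimage)
qed

text \<open>The set cut out is the complement of \<Omega>. It is closed and lies in the open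
  complement of \<open>P\<close>, as excision demands.\<close>

lemma excision_open_superset:
  fixes \<Omega> P :: "'a::euclidean_space set"
  assumes "open \<Omega>" "closed P" "P \<subseteq> \<Omega>"
  shows "hom_induced p (top_of_set \<Omega>) (\<Omega> - P) euclidean (- P) id \<in>
    iso (relative_homology_group p (top_of_set \<Omega>) (\<Omega> - P)) (relative_homology_group p euclidean (- P))"
proof -
  have "euclidean closure_of (- \<Omega>) \<subseteq> euclidean interior_of (- P)"
    using assms by (auto simp: interior_open open_Compl closure_closed closed_Compl)
  moreover have "UNIV - - \<Omega> = \<Omega>" and "- P - - \<Omega> = \<Omega> - P"
    by auto
  ultimately show ?thesis
    using homology_excision_axiom[of euclidean "- \<Omega>" "- P" UNIV p] by simp
qed

section \<open>Homotopy invariance of the Brouwer degree, in the case of degree zero\<close>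

text \<open>The class measured by the degree is carried along the homotopy to \<open>h 1\<close>,
  which misses \<open>b\<close> and so kills it. To evaluate the definite description, 0 is shown to
  be an admissible exponent and then the only one.\<close>

lemma brouwer_degree_homotopy_eq_0:
  fixes h :: "real \<Rightarrow> 'a::euclidean_space \<Rightarrow> 'a"
  assumes "open \<Omega>" "bounded \<Omega>"
    and cont: "continuous_on ({0..1} \<times> closure \<Omega>) (\<lambda>(t, x). h t x)"
    and front: "\<And>t x. t \<in> {0..1} \<Longrightarrow> x \<in> frontier \<Omega> \<Longrightarrow> h t x \<noteq> b"
    and final: "\<And>x. x \<in> \<Omega> \<Longrightarrow> h 1 x \<noteq> b"
  shows "brouwer_degree (h 0) \<Omega> b = 0"
proof -
  define n where "n = int DIM('a)"
  define X where "X = top_of_set \<Omega>"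
  define P where "P = {x \<in> \<Omega>. h 0 x = b}"
  define T where "T = {q \<in> {0..1} \<times> closure \<Omega>. (\<lambda>(t, x). h t x) q = b}"
  \<comment> \<open>The preimages of \<open>b\<close> at all times together. Projecting the closed
    set \<open>T\<close> along the compact interval keeps it closed, and the frontier condition
    keeps it inside \<Omega>.\<close>
  define Q where "Q = {x. \<exists>t. t \<in> {0..1} \<and> (t, x) \<in> T}"
  let ?Y = "relative_homology_group n euclidean (- {b})"
  have "closed T"
    unfolding T_def using cont by (intro continuous_closed_preimage_constant closed_Times) auto
  then have "closed Q"
    unfolding Q_def by (intro closed_compact_projection) auto
  have "Q \<subseteq> \<Omega>"
    using front \<open>open \<Omega>\<close> by (auto simp: Q_def T_def frontier_def interior_open)
  have "P \<subseteq> Q"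
    using closure_subset[of \<Omega>] by (force simp: P_def Q_def T_def)
  then have "P \<subseteq> \<Omega>" using \<open>Q \<subseteq> \<Omega>\<close> by simp
  have cont_at: "continuous_on (closure \<Omega>) (h t)" if "t \<in> {0..1}" for t
  proof -
    have "continuous_on (closure \<Omega>) ((\<lambda>(t, x). h t x) \<circ> (\<lambda>x. (t, x)))"
      using that by (intro continuous_on_compose continuous_on_subset[OF cont] continuous_intros) auto
    then show ?thesis by (simp add: o_def)
  qed
  \<comment> \<open>No preimage lies on the frontier, so \<open>P\<close> is also a preimage within
    a closed set and is therefore closed.\<close>
  have "P = {x \<in> closure \<Omega>. h 0 x = b}"
    using front[of 0] closure_subset[of \<Omega>] \<open>open \<Omega>\<close> by (auto simp: P_def frontier_def interior_open)
  then have "closed P"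
    using cont_at[of 0] by (simp add: continuous_closed_preimage_constant)
  have cmap: "continuous_map X euclidean (h t)" if "t \<in> {0..1}" for t
    using cont_at[OF that] closure_subset[of \<Omega>] by (simp add: X_def continuous_on_subset)
  have iso_P: "hom_induced n X (\<Omega> - P) euclidean (- P) id \<in>
      iso (relative_homology_group n X (\<Omega> - P)) (relative_homology_group n euclidean (- P))"
    unfolding X_def by (rule excision_open_superset) fact+
  have iso_Q: "hom_induced n X (\<Omega> - Q) euclidean (- Q) id \<in>
      iso (relative_homology_group n X (\<Omega> - Q)) (relative_homology_group n euclidean (- Q))"
    unfolding X_def by (rule excision_open_superset) fact+
  \<comment> \<open>Relative to \<open>\<Omega> - Q\<close> the homotopy is one of pairs, and \<open>h 1\<close> factors through the pair
    \<open>(H - {b}, H - {b})\<close>, whose homology is trivial.\<close>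
  have on_Q: "hom_induced n X (\<Omega> - Q) euclidean (- {b}) (h 0) c = \<one>\<^bsub>?Y\<^esub>" for c
  proof -
    have "continuous_map (prod_topology (top_of_set {0..1}) X) euclidean (\<lambda>(t, x). h t x)"
      using continuous_on_subset[OF cont Sigma_mono[OF order_refl closure_subset]]
      by (simp add: X_def)
    moreover have "h t x \<noteq> b" if "t \<in> {0..1}" "x \<in> \<Omega> - Q" for t x
      using that closure_subset[of \<Omega>] by (auto simp: Q_def T_def)
    ultimately have "homotopic_with (\<lambda>k. k \<in> (\<Omega> - Q) \<rightarrow> - {b}) X euclidean (h 0) (h 1)"
      unfolding homotopic_with_def by (intro exI[of _ "\<lambda>(t, x). h t x"]) auto
    then have "hom_induced n X (\<Omega> - Q) euclidean (- {b}) (h 0) c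
        = hom_induced n X (\<Omega> - Q) euclidean (- {b}) (id \<circ> h 1) c"
      using homology_homotopy_axiom by (metis id_comp)
    also have "\<dots> = hom_induced n (top_of_set (- {b})) (- {b}) euclidean (- {b}) id
        (hom_induced n X (\<Omega> - Q) (top_of_set (- {b})) (- {b}) (h 1) c)"
      using final cmap[of 1]
      by (intro hom_induced_compose'[symmetric]) (auto simp: X_def continuous_map_in_subtopology)
    also have "hom_induced n X (\<Omega> - Q) (top_of_set (- {b})) (- {b}) (h 1) c
        = \<one>\<^bsub>relative_homology_group n (top_of_set (- {b})) (- {b})\<^esub>"
      using trivial_relative_homology_group_topspace[of n "top_of_set (- {b})"]
        hom_induced_carrier[of n X "\<Omega> - Q" "top_of_set (- {b})" "- {b}" "h 1" c]
      by (auto simp: trivial_group_def)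
    also have "hom_induced n (top_of_set (- {b})) (- {b}) euclidean (- {b}) id \<dots> = \<one>\<^bsub>?Y\<^esub>"
      by (rule hom_one[OF hom_induced_hom]) auto
    finally show ?thesis .
  qed
  have zero: "hom_induced n X (\<Omega> - P) euclidean (- {b}) (h 0) c = \<one>\<^bsub>?Y\<^esub>"
    if PR: "P \<subseteq> ball 0 R" and bR: "b \<in> ball 0 R"
      and z: "z \<in> carrier (relative_homology_group n euclidean (- ball 0 R))"
      and c: "c \<in> carrier (relative_homology_group n X (\<Omega> - P))"
      and cz: "hom_induced n X (\<Omega> - P) euclidean (- P) id c =
             hom_induced n euclidean (- ball 0 R) euclidean (- P) id z" for R z c
  proof -
    have "R > 0" using bR norm_ge_zero[of b] by (simp del: norm_ge_zero)
    obtain R0 where "\<Omega> \<subseteq> ball 0 R0"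
      using \<open>bounded \<Omega>\<close> bounded_subset_ballD by blast
    define R' where "R' = max R R0"
    have R': "R \<le> R'" "Q \<subseteq> ball 0 R'"
      using \<open>\<Omega> \<subseteq> ball 0 R0\<close> \<open>Q \<subseteq> \<Omega>\<close> by (auto simp: R'_def)
    obtain z' where z': "z' \<in> carrier (relative_homology_group n euclidean (- ball (0::'a) R'))"
      and zz': "hom_induced n euclidean (- ball 0 R') euclidean (- ball 0 R) id z' = z"
      by (rule surj_relative_homology_complement_ball[OF \<open>R > 0\<close> R'(1) z])
    obtain c' where c': "c' \<in> carrier (relative_homology_group n X (\<Omega> - Q))"
      and cz': "hom_induced n X (\<Omega> - Q) euclidean (- Q) id c'
        = hom_induced n euclidean (- ball 0 R') euclidean (- Q) id z'"
      by (rule iso_preimage[OF iso_Q hom_induced_carrier])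
    \<comment> \<open>\<open>c\<close> lifts to \<open>(\<Omega>, \<Omega> - Q)\<close> only because it comes from the complement of a ball;
      a ball around \<open>P\<close> need not contain \<open>Q\<close>, so it is enlarged first.\<close>
    let ?c = "hom_induced n X (\<Omega> - Q) X (\<Omega> - P) id c'"
    have "hom_induced n X (\<Omega> - P) euclidean (- P) id ?c
        = hom_induced n X (\<Omega> - Q) euclidean (- P) (id \<circ> id) c'"
      using \<open>P \<subseteq> Q\<close> by (intro hom_induced_compose') (auto simp: X_def)
    also have "\<dots> = hom_induced n euclidean (- Q) euclidean (- P) id
        (hom_induced n X (\<Omega> - Q) euclidean (- Q) id c')"
      using \<open>P \<subseteq> Q\<close> by (intro hom_induced_compose'[symmetric]) (auto simp: X_def)
    also have "\<dots> = hom_induced n euclidean (- ball 0 R') euclidean (- P) (id \<circ> id) z'"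
      unfolding cz' using \<open>P \<subseteq> Q\<close> R' by (intro hom_induced_compose') auto
    also have "\<dots> = hom_induced n euclidean (- ball 0 R) euclidean (- P) id z"
      unfolding zz'[symmetric] using PR R' by (intro hom_induced_compose'[symmetric]) auto
    finally have "hom_induced n X (\<Omega> - P) euclidean (- P) id ?c
        = hom_induced n X (\<Omega> - P) euclidean (- P) id c"
      using cz by metis
    moreover have "inj_on (hom_induced n X (\<Omega> - P) euclidean (- P) id)
        (carrier (relative_homology_group n X (\<Omega> - P)))"
      using iso_P by (simp add: iso_def bij_betw_def)
    ultimately have "?c = c"
      using c hom_induced_carrier by (metis inj_onD)
    then have "hom_induced n X (\<Omega> - P) euclidean (- {b}) (h 0) c
        = hom_induced n X (\<Omega> - P) euclidean (- {b}) (h 0) ?c"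
      by simp
    also have "\<dots> = hom_induced n X (\<Omega> - Q) euclidean (- {b}) (h 0 \<circ> id) c'"
      using \<open>P \<subseteq> Q\<close> cmap[of 0] by (intro hom_induced_compose') (auto simp: P_def X_def)
    finally show ?thesis
      by (simp add: on_Q)
  qed
  define is_deg where "is_deg d \<longleftrightarrow> (\<forall>R z c.
           P \<subseteq> ball 0 R \<and> b \<in> ball 0 R \<and>
           z \<in> carrier (relative_homology_group n euclidean (- ball 0 R)) \<and>
           c \<in> carrier (relative_homology_group n X (\<Omega> - P)) \<and>
           hom_induced n X (\<Omega> - P) euclidean (- P) id c =
             hom_induced n euclidean (- ball 0 R) euclidean (- P) id z
           \<longrightarrow>
           hom_induced n X (\<Omega> - P) euclidean (- {b}) (h 0) c =
             hom_induced n euclidean (- ball 0 R) euclidean (- {b}) id z [^]\<^bsub>?Y\<^esub> d)" for d :: int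
  have deg: "brouwer_degree (h 0) \<Omega> b = (THE d. is_deg d)"
    unfolding brouwer_degree_def is_deg_def n_def X_def P_def Let_def by (rule refl)
  have "is_deg 0"
    unfolding is_deg_def
  proof (intro allI impI, elim conjE)
    fix R z c
    assume "P \<subseteq> ball 0 R" "b \<in> ball 0 R"
      "z \<in> carrier (relative_homology_group n euclidean (- ball (0::'a) R))"
      "c \<in> carrier (relative_homology_group n X (\<Omega> - P))"
      "hom_induced n X (\<Omega> - P) euclidean (- P) id c =
        hom_induced n euclidean (- ball 0 R) euclidean (- P) id z"
    then have "hom_induced n X (\<Omega> - P) euclidean (- {b}) (h 0) c = \<one>\<^bsub>?Y\<^esub>"
      by (rule zero)
    then show "hom_induced n X (\<Omega> - P) euclidean (- {b}) (h 0) c =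
        hom_induced n euclidean (- ball 0 R) euclidean (- {b}) id z [^]\<^bsub>?Y\<^esub> (0::int)"
      by (simp only: int_pow_0)
  qed
  moreover have "d = 0" if "is_deg d" for d
  proof -
    \<comment> \<open>Uniqueness requires that the defining condition not be vacuous. A large ball
      gives \<open>z\<close> whose image has infinite order, and excision gives a matching
      \<open>c\<close>.\<close>
    obtain R where R: "insert b \<Omega> \<subseteq> ball 0 R"
      using \<open>bounded \<Omega>\<close> by (metis bounded_insert bounded_subset_ballD)
    have PR: "P \<subseteq> ball 0 R" and bR: "b \<in> ball 0 R"
      using R \<open>P \<subseteq> \<Omega>\<close> by auto
    obtain z where z: "z \<in> carrier (relative_homology_group n euclidean (- ball (0::'a) R))"
      and z_inf: "\<forall>d::int. hom_induced n euclidean (- ball 0 R) euclidean (- {b}) id z [^]\<^bsub>?Y\<^esub> d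
           = \<one>\<^bsub>?Y\<^esub> \<longrightarrow> d = 0"
      by (rule infinite_order_punctured_space[OF bR, folded n_def])
    obtain c where c: "c \<in> carrier (relative_homology_group n X (\<Omega> - P))"
      and cz: "hom_induced n X (\<Omega> - P) euclidean (- P) id c
        = hom_induced n euclidean (- ball 0 R) euclidean (- P) id z"
      by (rule iso_preimage[OF iso_P hom_induced_carrier])
    have "hom_induced n euclidean (- ball 0 R) euclidean (- {b}) id z [^]\<^bsub>?Y\<^esub> d
        = hom_induced n X (\<Omega> - P) euclidean (- {b}) (h 0) c"
      by (rule that[unfolded is_deg_def, rule_format, symmetric], intro conjI) fact+
    also have "\<dots> = \<one>\<^bsub>?Y\<^esub>"
      by (rule zero[OF PR bR z c cz])
    finally show "d = 0"
      by (rule z_inf[rule_format])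
  qed
  ultimately show ?thesis
    unfolding deg by (rule the_equality)
qed

section \<open>Asymptotics of weakly homogeneous mappings\<close>

lemma is_leading_term_continuous_on:
  assumes "is_leading_term D \<delta> \<phi> h"
  shows "continuous_on D \<phi>"
proof -
  obtain e where "continuous_on D h" "continuous_on D e" and eq: "\<forall>x\<in>D. \<phi> x = h x + e x"
    using assms by (auto simp: is_leading_term_def positively_homogeneous_on_def)
  then have "continuous_on D (\<lambda>x. h x + e x)"
    by (intro continuous_intros)
  then show ?thesis
    using eq continuous_on_cong by fastforce
qed

text \<open>Homogeneity moves the scaling inside \<open>h\<close>, and the remainder vanishes in the
  limit. The constant \<open>c\<close> vanishes as well, so differences from a fixed vector have the
  same limit.\<close>

lemma is_leading_term_tendsto:
  assumes lt: "is_leading_term D \<delta> \<phi> h" and "\<delta> > 0" and "conic D"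
    and x: "\<And>k::nat. x k \<in> D" and x_top: "filterlim (\<lambda>k. norm (x k)) at_top sequentially"
    and u: "(\<lambda>k. x k /\<^sub>R norm (x k)) \<longlonglongrightarrow> u" "u \<in> D"
  shows "(\<lambda>k. (\<phi> (x k) - c) /\<^sub>R (norm (x k) powr \<delta>)) \<longlonglongrightarrow> h u"
proof -
  obtain e where cont: "continuous_on D h"
    and hom: "\<And>y l. y \<in> D \<Longrightarrow> l > 0 \<Longrightarrow> h (l *\<^sub>R y) = (l powr \<delta>) *\<^sub>R h y"
    and eq: "\<And>y. y \<in> D \<Longrightarrow> \<phi> y = h y + e y"
    and e: "((\<lambda>x. e x /\<^sub>R (norm x powr \<delta>)) \<longlongrightarrow> 0) (inf at_infinity (principal D))"
    using lt by (auto simp: is_leading_term_def positively_homogeneous_on_def)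
  \<comment> \<open>For \<open>x k = 0\<close> the quotient is 0, which lies in \<open>D\<close>
    because a conic set admits the factor 0.\<close>
  have in_D: "x k /\<^sub>R norm (x k) \<in> D" for k
    using \<open>conic D\<close> x by (simp add: conic_def)
  have "(\<lambda>k. h (x k /\<^sub>R norm (x k))) \<longlonglongrightarrow> h u"
    using continuous_on_tendsto_compose[OF cont u] in_D by simp
  moreover have "(\<lambda>k. e (x k) /\<^sub>R (norm (x k) powr \<delta>)) \<longlonglongrightarrow> 0"
  proof (rule filterlim_compose[OF e])
    show "filterlim x (inf at_infinity (principal D)) sequentially"
      using x x_top by (simp add: filterlim_inf filterlim_principal filterlim_at_infinity_conv_norm_at_top)
  qed
  moreover have "(\<lambda>k. c /\<^sub>R (norm (x k) powr \<delta>)) \<longlonglongrightarrow> 0"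
  proof -
    have "filterlim (\<lambda>k. norm (x k) powr \<delta>) at_top sequentially"
      using filterlim_compose[OF real_powr_at_top[OF \<open>\<delta> > 0\<close>] x_top] .
    then have "(\<lambda>k. inverse (norm (x k) powr \<delta>)) \<longlonglongrightarrow> 0"
      by (rule tendsto_inverse_0_at_top)
    from tendsto_scaleR[OF this tendsto_const[of c]] show ?thesis by simp
  qed
  ultimately have "(\<lambda>k. h (x k /\<^sub>R norm (x k)) + e (x k) /\<^sub>R (norm (x k) powr \<delta>)
      - c /\<^sub>R (norm (x k) powr \<delta>)) \<longlonglongrightarrow> h u + 0 - 0"
    by (intro tendsto_intros)
  moreover have "\<forall>\<^sub>F k in sequentially. h (x k /\<^sub>R norm (x k)) + e (x k) /\<^sub>R (norm (x k) powr \<delta>)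
      - c /\<^sub>R (norm (x k) powr \<delta>) = (\<phi> (x k) - c) /\<^sub>R (norm (x k) powr \<delta>)"
  proof -
    have "\<forall>\<^sub>F k in sequentially. norm (x k) > 0"
      using x_top unfolding filterlim_at_top_dense by blast
    then show ?thesis
    proof eventually_elim
      case (elim k)
      then have "h (x k /\<^sub>R norm (x k)) = h (x k) /\<^sub>R (norm (x k) powr \<delta>)"
        using hom[OF x, of "inverse (norm (x k))" k] by (simp add: inverse_powr)
      then show ?case
        by (simp add: eq[OF x] scaleR_add_right scaleR_diff_right)
    qed
  qed
  ultimately have "(\<lambda>k. (\<phi> (x k) - c) /\<^sub>R (norm (x k) powr \<delta>)) \<longlonglongrightarrow> h u + 0 - 0"
    by (rule Lim_transform_eventually)
  then show ?thesis
    by simp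
qed

section \<open>Projection onto \<open>K\<close>, a priori bound, existence and uniqueness\<close>

text \<open>The obtuse angle criterion. For \<open>p = g x\<close> and \<open>a = g x - f x\<close>
  it is the variational inequality itself.\<close>

lemma eq_closest_point_iff:
  fixes K :: "'a::euclidean_space set"
  assumes "K \<noteq> {}" "closed K" "convex K"
  shows "p = closest_point K a \<longleftrightarrow> p \<in> K \<and> (\<forall>y\<in>K. (a - p) \<bullet> (y - p) \<le> 0)"
proof
  assume "p = closest_point K a"
  then show "p \<in> K \<and> (\<forall>y\<in>K. (a - p) \<bullet> (y - p) \<le> 0)"
    using assms closest_point_in_set closest_point_dot by metis
next
  assume p: "p \<in> K \<and> (\<forall>y\<in>K. (a - p) \<bullet> (y - p) \<le> 0)"
  have "dist a p \<le> dist a y" if "y \<in> K" for y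
  proof -
    have "(norm (a - p))\<^sup>2 \<le> (norm (a - y))\<^sup>2"
    proof -
      have "(norm (a - y))\<^sup>2 = (norm (a - p))\<^sup>2 + (norm (y - p))\<^sup>2 - 2 * ((a - p) \<bullet> (y - p))"
        by (simp add: power2_norm_eq_inner inner_diff inner_commute algebra_simps)
      then show ?thesis
        using p that by (smt (verit) zero_le_power2)
    qed
    then show ?thesis
      by (simp add: dist_norm)
  qed
  then show "p = closest_point K a"
    using assms p closest_point_unique by blast
qed

text \<open>Along an unbounded sequence both parts of the deformed inequality, weighted by
  \<open>t\<close> and \<open>1 - t\<close>, eventually have the wrong sign. The parameters
  \<open>t k\<close> need not converge, since each part is treated separately.\<close>

lemma homotopy_zeros_bounded:
  fixes C K :: "'a::euclidean_space set"
  assumes C: "closed C" "conic C"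
    and K: "K \<noteq> {}" "closed K" "convex K"
    and \<delta>: "\<alpha> > 0" "\<beta> > 0"
    and f: "is_leading_term C \<alpha> f finf"
    and g: "is_leading_term UNIV \<beta> g ginf"
    and gK: "g -` K \<subseteq> C"
    and mono: "strictly_monotone_wrt f g K"
    and nz: "\<forall>x\<in>C. norm x = 1 \<and> ginf x \<in> recession_cone K \<longrightarrow> finf x \<bullet> ginf x \<noteq> 0"
  shows "bounded {x. \<exists>t\<in>{0..1}. g x = closest_point K (t *\<^sub>R (g x - f x) + (1 - t) *\<^sub>R a)}"
    (is "bounded ?Z")
proof (rule ccontr)
  assume unb: "\<not> bounded ?Z"
  define Z where "Z = ?Z"
  have "\<forall>k::nat. \<exists>x. x \<in> Z \<and> norm x > real k"
    using unb unfolding bounded_iff Z_def[symmetric] by (meson not_le)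
  from choice[OF this] obtain x0
    where x0: "\<And>k. x0 k \<in> Z" "\<And>k::nat. norm (x0 k) > real k"
    by blast
  have in_sphere: "x0 k /\<^sub>R norm (x0 k) \<in> sphere 0 1" for k
  proof -
    have "norm (x0 k) > 0"
      using x0(2)[of k] by (rule le_less_trans[OF of_nat_0_le_iff])
    then show ?thesis by simp
  qed
  obtain u r where u: "u \<in> sphere 0 1" and r: "strict_mono (r::nat \<Rightarrow> nat)"
    and lim0: "((\<lambda>k. x0 k /\<^sub>R norm (x0 k)) \<circ> r) \<longlonglongrightarrow> u"
    by (rule seq_compactE[OF compact_imp_seq_compact[OF compact_sphere] allI[OF in_sphere]])
  define x where "x = x0 \<circ> r"
  have lim: "(\<lambda>k. x k /\<^sub>R norm (x k)) \<longlonglongrightarrow> u"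
    using lim0 by (simp add: x_def o_def)
  have "real k \<le> norm (x k)" for k
    using x0(2)[of "r k"] seq_suble[OF r, of k] by (simp add: x_def)
  then have x_top: "filterlim (\<lambda>k. norm (x k)) at_top sequentially"
    using filterlim_at_top_mono[OF filterlim_real_sequentially] by (simp add: eventually_sequentially)
  have "\<forall>k. \<exists>t. t \<in> {0..1} \<and> g (x k) = closest_point K (t *\<^sub>R (g (x k) - f (x k)) + (1 - t) *\<^sub>R a)"
    using x0(1) unfolding x_def Z_def comp_def by blast
  from choice[OF this] obtain t where t: "\<And>k. t k \<in> {0..1}"
    and xt: "\<And>k. g (x k) = closest_point K (t k *\<^sub>R (g (x k) - f (x k)) + (1 - t k) *\<^sub>R a)"
    by blast
  have gx: "g (x k) \<in> K" for k
    using xt[of k] closest_point_in_set[OF K(2,1)] by metis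
  then have xC: "x k \<in> C" for k
    using gK by auto
  have "u \<in> C"
    using closed_sequentially[OF \<open>closed C\<close> _ lim] xC \<open>conic C\<close> by (simp add: conic_def)
  have limf: "(\<lambda>k. (f (x k) - c) /\<^sub>R (norm (x k) powr \<alpha>)) \<longlonglongrightarrow> finf u" for c
    by (rule is_leading_term_tendsto[OF f \<delta>(1) C(2) xC x_top lim \<open>u \<in> C\<close>])
  have limg: "(\<lambda>k. (g (x k) - c) /\<^sub>R (norm (x k) powr \<beta>)) \<longlonglongrightarrow> ginf u" for c
    by (rule is_leading_term_tendsto[OF g \<delta>(2) _ _ x_top lim]) (auto simp: conic_def)
  have "ginf u \<in> recession_cone K"
    unfolding recession_cone_def mem_Collect_eq
  proof (intro exI conjI)
    \<comment> \<open>The scaling factors of the recession cone are the powers of the norm that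
      normalise \<open>g\<close>.\<close>
    show "filterlim (\<lambda>k. norm (x k) powr \<beta>) at_top sequentially"
      using filterlim_compose[OF real_powr_at_top[OF \<delta>(2)] x_top] .
    show "\<forall>k. g (x k) \<in> K" using gx by simp
    show "(\<lambda>k. g (x k) /\<^sub>R (norm (x k) powr \<beta>)) \<longlonglongrightarrow> ginf u"
      using limg[of 0] by simp
  qed
  then have ne: "finf u \<bullet> ginf u \<noteq> 0"
    using nz \<open>u \<in> C\<close> u by simp
  \<comment> \<open>Monotonicity is applied to \<open>x k\<close> and the fixed point
    \<open>x 0\<close>; after normalisation the limit retains the sign.\<close>
  have "0 \<le> finf u \<bullet> ginf u"
  proof (rule tendsto_lowerbound[OF tendsto_inner[OF limf[of "f (x 0)"] limg[of "g (x 0)"]]])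
    have "0 \<le> (f (x k) - f (x 0)) \<bullet> (g (x k) - g (x 0))" for k
      using mono gx[of k] gx[of 0] unfolding strictly_monotone_wrt_def
      by (cases "x k = x 0") (auto intro: less_imp_le)
    then show "\<forall>\<^sub>F k in sequentially. 0 \<le> ((f (x k) - f (x 0)) /\<^sub>R (norm (x k) powr \<alpha>)) \<bullet>
        ((g (x k) - g (x 0)) /\<^sub>R (norm (x k) powr \<beta>))"
      by simp
  qed simp
  \<comment> \<open>The first product controls the part with \<open>f\<close>. It also excludes
    \<open>ginf u = 0\<close>, and the second then controls the part with \<open>a\<close>.\<close>
  then have pos: "0 < finf u \<bullet> ginf u" "0 < ginf u \<bullet> ginf u"
    using ne by auto
  have "\<forall>\<^sub>F k in sequentially. 0 < ((f (x k) - 0) /\<^sub>R (norm (x k) powr \<alpha>)) \<bullet>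
        ((g (x k) - g (x 0)) /\<^sub>R (norm (x k) powr \<beta>))"
    using order_tendstoD(1)[OF tendsto_inner[OF limf limg] pos(1)] .
  moreover have "\<forall>\<^sub>F k in sequentially. 0 < ((g (x k) - a) /\<^sub>R (norm (x k) powr \<beta>)) \<bullet>
        ((g (x k) - g (x 0)) /\<^sub>R (norm (x k) powr \<beta>))"
    using order_tendstoD(1)[OF tendsto_inner[OF limg limg] pos(2)] .
  moreover have "\<forall>\<^sub>F k in sequentially. norm (x k) > 0"
    using x_top unfolding filterlim_at_top_dense by blast
  ultimately have "\<forall>\<^sub>F k in sequentially. False"
  proof eventually_elim
    case (elim k)
    have A: "0 < f (x k) \<bullet> (g (x k) - g (x 0))" and B: "0 < (g (x k) - a) \<bullet> (g (x k) - g (x 0))"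
      using elim by (simp_all add: zero_less_mult_iff)
    \<comment> \<open>The projection criterion tested with \<open>g (x 0)\<close>, a point of
      \<open>K\<close> independent of \<open>k\<close>.\<close>
    have "(t k *\<^sub>R (g (x k) - f (x k)) + (1 - t k) *\<^sub>R a - g (x k)) \<bullet> (g (x 0) - g (x k)) \<le> 0"
      using eq_closest_point_iff[OF K, THEN iffD1, OF xt[of k]] gx[of 0] by blast
    also have "(t k *\<^sub>R (g (x k) - f (x k)) + (1 - t k) *\<^sub>R a - g (x k)) \<bullet> (g (x 0) - g (x k))
        = t k * (f (x k) \<bullet> (g (x k) - g (x 0))) + (1 - t k) * ((g (x k) - a) \<bullet> (g (x k) - g (x 0)))"
      by (simp add: inner_diff_left inner_diff_right inner_add_left algebra_simps)
    finally have le: "t k * (f (x k) \<bullet> (g (x k) - g (x 0)))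
        + (1 - t k) * ((g (x k) - a) \<bullet> (g (x k) - g (x 0))) \<le> 0" .
    show False
    proof (cases "t k = 0")
      case True
      then show False using le B by simp
    next
      case False
      then have "0 < t k * (f (x k) \<bullet> (g (x k) - g (x 0)))"
        using A t[of k] by simp
      moreover have "0 \<le> (1 - t k) * ((g (x k) - a) \<bullet> (g (x k) - g (x 0)))"
        using B t[of k] by simp
      ultimately show False using le by linarith
    qed
  qed
  then show False by simp
qed

lemma WHGVI_solution_exists:
  fixes C K :: "'a::euclidean_space set"
  assumes C: "closed C" "conic C"
    and K: "K \<noteq> {}" "closed K" "convex K"
    and \<delta>: "\<alpha> > 0" "\<beta> > 0"
    and f: "is_leading_term C \<alpha> f finf"
    and g: "is_leading_term UNIV \<beta> g ginf"
    and gK: "g -` K \<subseteq> C"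
    and deg: "\<And>r. r > norm (closest_point K a) \<Longrightarrow>
           degree_defined g {x. norm (g x) < r} (closest_point K a) \<and>
           brouwer_degree g {x. norm (g x) < r} (closest_point K a) \<noteq> 0"
    and mono: "strictly_monotone_wrt f g K"
    and nz: "\<forall>x\<in>C. norm x = 1 \<and> ginf x \<in> recession_cone K \<longrightarrow> finf x \<bullet> ginf x \<noteq> 0"
  shows "\<exists>x. WHGVI_solution f g K x"
proof (rule ccontr)
  assume no_sol: "\<nexists>x. WHGVI_solution f g K x"
  \<comment> \<open>The homotopy must be continuous off \<open>C\<close> too, hence the Tietze
    extension. It creates no spurious zeros: a zero has \<open>g x\<close> in \<open>K\<close>, so
    it lies in \<open>C\<close>, where \<open>F\<close> is \<open>f\<close>.\<close>
  obtain F where F: "continuous_on UNIV F" and Ff: "\<And>x. x \<in> C \<Longrightarrow> F x = f x"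
    using Tietze_unbounded[OF is_leading_term_continuous_on[OF f], of UNIV] C(1)
    unfolding subtopology_UNIV closed_closedin by metis
  define b where "b = closest_point K a"
  define \<Phi> where "\<Phi> t x = closest_point K (t *\<^sub>R (g x - F x) + (1 - t) *\<^sub>R a)" for t x
  have FfK: "F x = f x" if "g x = \<Phi> t x" for t x
    using that closest_point_in_set[OF K(2,1)] gK Ff unfolding \<Phi>_def by (metis subsetD vimageI)
  have contg: "continuous_on UNIV g"
    using is_leading_term_continuous_on[OF g] .
  have "bounded {x. \<exists>t\<in>{0..1}. g x = closest_point K (t *\<^sub>R (g x - f x) + (1 - t) *\<^sub>R a)}"
    by (rule homotopy_zeros_bounded) fact+
  then obtain M where M: "norm x \<le> M" if "t \<in> {0..1}" "g x = \<Phi> t x" for t x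
    unfolding bounded_iff using FfK unfolding \<Phi>_def by (metis (mono_tags, lifting) mem_Collect_eq)
  have "bounded (g ` cball 0 M)"
    using contg by (intro compact_imp_bounded compact_continuous_image) (auto intro: continuous_on_subset)
  then obtain B where B: "norm (g x) \<le> B" if "norm x \<le> M" for x
    unfolding bounded_iff by (metis imageI mem_cball_0)
  \<comment> \<open>Exceeding \<open>norm b\<close> makes the degree hypothesis applicable;
    exceeding \<open>B\<close> puts every zero of the homotopy inside \<Omega>, off its
    frontier.\<close>
  define r where "r = max B (norm b) + 1"
  define \<Omega> where "\<Omega> = {x. norm (g x) < r}"
  \<comment> \<open>Adding \<open>b\<close> makes the solutions of \<open>g x = \<Phi> t x\<close>
    the preimages of \<open>b\<close>. As \<open>\<Phi> 0\<close> is constantly \<open>b\<close>,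
    the homotopy starts exactly at \<open>g\<close>.\<close>
  define h where "h t x = g x - \<Phi> t x + b" for t x
  have defd: "open \<Omega>" "bounded \<Omega>" and deg_nz: "brouwer_degree g \<Omega> b \<noteq> 0"
    using deg[of r] by (auto simp: degree_defined_def \<Omega>_def b_def r_def)
  have zero_in: "x \<in> \<Omega>" if "t \<in> {0..1}" "h t x = b" for t x
    using B[OF M[OF that(1)], of x] that(2) by (simp add: h_def \<Omega>_def r_def)
  have "brouwer_degree (h 0) \<Omega> b = 0"
  proof (rule brouwer_degree_homotopy_eq_0[OF defd])
    have "continuous_on UNIV (\<lambda>q. h (fst q) (snd q))"
      unfolding h_def \<Phi>_def
      by (intro continuous_intros continuous_on_compose2[OF contg] continuous_on_compose2[OF F]
          continuous_on_compose2[OF continuous_on_closest_point[OF K(3,2,1), of UNIV]]) auto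
    then show "continuous_on ({0..1} \<times> closure \<Omega>) (\<lambda>(t, x). h t x)"
      by (auto simp: case_prod_unfold intro: continuous_on_subset)
    show "h t x \<noteq> b" if "t \<in> {0..1}" "x \<in> frontier \<Omega>" for t x
      using zero_in[OF that(1)] that(2) defd(1) by (auto simp: frontier_def interior_open)
    show "h 1 x \<noteq> b" for x
    proof
      assume "h 1 x = b"
      then have eq: "g x = \<Phi> 1 x" by (simp add: h_def)
      then have "g x = closest_point K (g x - f x)"
        using FfK[OF eq] by (simp add: \<Phi>_def)
      then have "g x \<in> K" and "\<forall>y\<in>K. (g x - f x - g x) \<bullet> (y - g x) \<le> 0"
        using eq_closest_point_iff[OF K] by blast+
      then have "WHGVI_solution f g K x"
        by (simp add: WHGVI_solution_def)
      then show False using no_sol by blast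
    qed
  qed
  moreover have "h 0 = g"
    by (simp add: h_def \<Phi>_def b_def fun_eq_iff)
  ultimately show False
    using deg_nz by simp
qed

text \<open>Each inequality is tested with the \<open>g\<close>-value of the other solution; their
  sum contradicts strict monotonicity.\<close>

lemma WHGVI_solution_unique:
  assumes "strictly_monotone_wrt f g K" "WHGVI_solution f g K x" "WHGVI_solution f g K y"
  shows "x = y"
proof (rule ccontr)
  assume "x \<noteq> y"
  then have "(f x - f y) \<bullet> (g x - g y) > 0"
    using assms by (simp add: strictly_monotone_wrt_def WHGVI_solution_def)
  moreover have "f x \<bullet> (g y - g x) \<ge> 0" "f y \<bullet> (g x - g y) \<ge> 0"
    using assms by (simp_all add: WHGVI_solution_def)
  ultimately show False
    by (simp add: inner_diff_left inner_diff_right)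
qed

theorem mainTheorem3:
  fixes C K :: "'a::euclidean_space set"
    and f g finf ginf :: "'a \<Rightarrow> 'a"
    and \<delta>1 \<delta>2 :: real
  assumes "closed C" and "convex_cone C"
    and "K \<noteq> {}" and "closed K" and "convex K"
    and "\<delta>1 > 0" and "\<delta>2 > 0"
    and "weakly_homogeneous_on C \<delta>1 f" and "is_leading_term C \<delta>1 f finf"
    and "weakly_homogeneous_on UNIV \<delta>2 g" and "is_leading_term UNIV \<delta>2 g ginf"
    and "g -` K \<subseteq> C"
    and "\<forall>xhat r. r > norm (closest_point K xhat) \<longrightarrow>
           degree_defined g {x. norm (g x) < r} (closest_point K xhat) \<and>
           brouwer_degree g {x. norm (g x) < r} (closest_point K xhat) \<noteq> 0"
    and "strictly_monotone_wrt f g K"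
    and "\<forall>x\<in>C. norm x = 1 \<and> ginf x \<in> recession_cone K \<longrightarrow> finf x \<bullet> ginf x \<noteq> 0"
  shows "\<exists>!x. WHGVI_solution f g K x"
proof -
  have "conic C"
    using \<open>convex_cone C\<close> by (simp add: convex_cone_def)
  then have "\<exists>x. WHGVI_solution f g K x"
    using assms by (intro WHGVI_solution_exists[where a = 0 and \<alpha> = \<delta>1 and \<beta> = \<delta>2]) simp_all
  then show ?thesis
    using WHGVI_solution_unique[OF \<open>strictly_monotone_wrt f g K\<close>] by blast
qed

end
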